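(* Let $\omega \in \Omega^*$, and let $\nu_\omega$ be the associated charge on $\mathcal{P}(\mathbb{N})$. Then $\nu_{\omega}$ has the additive property if and only if $\omega \notin \mathcal{R}_-$.
   Context: Additive property: a charge on $(\mathbb{N}, \mathcal{P}(\mathbb{N}))$ is a nonnegative, bounded, finitely additive function $\mu$ on the set $\mathcal{P}(\mathbb{N})$ of all subsets of $\mathbb{N}=\{1,2,\ldots\}$, with $\mu(\emptyset)=0$. It has the additive property if for every $\varepsilon > 0$ and every increasing sequence $A_1 \subseteq A_2 \subseteq \cdots$ of subsets of $\mathbb{N}$ there exists $B \subseteq \mathbb{N}$ such that (1) $\mu(B) \le \lim_{i \to \infty} \mu(A_i) + \varepsilon$ and (2) $\mu(A_i \setminus B) = 0$ for every $i = 1, 2, \ldots$. Limit along an ultrafilter: for an ultrafilter $\mathcal{U}$ on $\mathbb{N}$ and a bounded function $f : \mathbb{N} \to \mathbb{R}$, $\mathcal{U}\text{-}\lim_n f(n)$ is the unique real number $\alpha$ such that $\{n \in \mathbb{N} : |f(n) - \alpha| < \varepsilon\} \in \mathcal{U}$ for every $\varepsilon > 0$. The space $\mathbb{N}^*$ and the map $\tau$: $\beta\mathbb{N}$ is the Stone–Čech compactification of $\mathbb{N}$, identified with the set of all ultrafilters on $\mathbb{N}$, with basis of open sets $\hat{A} = \{\mathcal{U} : A \in \mathcal{U}\}$, $A \subseteq \mathbb{N}$. $\mathbb{N}^* = \beta\mathbb{N} \setminus \mathbb{N}$ is the set of free ultrafilters with the relative topology. The translation $n \mapsto n+1$ on $\mathbb{N}$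 extends to a continuous map $\tau : \beta\mathbb{N} \to \beta\mathbb{N}$, whose restriction to $\mathbb{N}^*$, again denoted $\tau$, is a homeomorphism of $\mathbb{N}^*$ onto itself. The flow on $\Omega^*$: $\Omega^*$ is the quotient space of $\mathbb{N}^* \times [0,1]$ by the equivalence relation generated by $(\mathcal{U}, 1) \sim (\tau\mathcal{U}, 0)$ for $\mathcal{U} \in \mathbb{N}^*$. For $s \in \mathbb{R}$, the homeomorphism $\tau^s : \Omega^* \to \Omega^*$ is $\tau^s(\mathcal{U}, t) = (\tau^{[t+s]}\mathcal{U},\, t+s-[t+s])$, where $[x]$ denotes the largest integer not exceeding $x$. Recurrent points: $\mathcal{R}_-$ is the set of all $\omega \in \Omega^*$ whose negative semi-orbit $\{\tau^{-s}\omega : s \ge 0\}$ is recurrent, i.e. such that for every neighborhood $U$ of $\omega$ in $\Omega^*$ and every real $R > 0$ there exists $s \ge R$ with $\tau^{-s}\omega \in U$. The charge $\nu_\omega$: for $\omega = (\mathcal{U}, t) \in \Omega^*$ put $\theta = 2^t$ and $$\nu_{\omega}(A) = \mathcal{U}\text{-}\lim_n \frac{|A \cap [1, [\theta \cdot 2^n]]|}{\theta \cdot 2^n}, \qquad A \in \mathcal{P}(\mathbb{N}),$$ where $|\cdot|$ denotes the number of elements (this is well defined on $\Omega^*$). *)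

theory Defs
  imports "HOL-Analysis.Analysis"
begin

section \<open>Charges on the positive integers\<close>

text \<open>The set \<open>{1, 2, \<dots>}\<close> is a subset of the type \<^typ>\<open>nat\<close>. Set functions
  have the type \<^typ>\<open>nat set \<Rightarrow> real\<close>, and only their values on subsets of \<open>posN\<close> matter.\<close>

definition posN :: "nat set" where
  "posN = {1..}"

definition charge :: "(nat set \<Rightarrow> real) \<Rightarrow> bool" where
  "charge \<mu> \<longleftrightarrow>
     (\<forall>A\<subseteq>posN. 0 \<le> \<mu> A) \<and>
     (\<exists>C. \<forall>A\<subseteq>posN. \<mu> A \<le> C) \<and>
     (\<forall>A\<subseteq>posN. \<forall>B\<subseteq>posN. A \<inter> B = {} \<longrightarrow> \<mu> (A \<union> B) = \<mu> A + \<mu> B) \<and>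
     \<mu> {} = 0"

text \<open>The condition is meant for set functions satisfying \<^const>\<open>charge\<close>; for these,
  \<open>\<lambda>i. \<mu> (A i)\<close> is bounded and monotone, so that the limit exists.\<close>

definition additive_property :: "(nat set \<Rightarrow> real) \<Rightarrow> bool" where
  "additive_property \<mu> \<longleftrightarrow>
     (\<forall>\<epsilon>>0. \<forall>A :: nat \<Rightarrow> nat set. incseq A \<and> (\<forall>i. A i \<subseteq> posN) \<longrightarrow>
        (\<exists>B\<subseteq>posN. \<mu> B \<le> lim (\<lambda>i. \<mu> (A i)) + \<epsilon> \<and> (\<forall>i. \<mu> (A i - B) = 0)))"


section \<open>Ultrafilters and the Stone-Cech compactification\<close>

text \<open>An ultrafilter on \<open>posN\<close> is a filter \<open>U\<close> in the sense of \<^typ>\<open>nat filter\<close> that contains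
  \<open>posN\<close>; membership \<open>A \<in> U\<close> is \<open>\<forall>\<^sub>F n in U. n \<in> A\<close>. The limit of a bounded real
  function \<open>f\<close> along \<open>U\<close> is \<open>Lim U f\<close> of the library.\<close>

definition ultrafilter :: "'a filter \<Rightarrow> bool" where
  "ultrafilter U \<longleftrightarrow>
     U \<noteq> bot \<and> (\<forall>A. (\<forall>\<^sub>F x in U. x \<in> A) \<or> (\<forall>\<^sub>F x in U. x \<in> - A))"

definition betaN :: "nat filter set" where
  "betaN = {U. ultrafilter U \<and> (\<forall>\<^sub>F n in U. n \<in> posN)}"

definition hat :: "nat set \<Rightarrow> nat filter set" where
  "hat A = {U \<in> betaN. \<forall>\<^sub>F n in U. n \<in> A}"

definition betaN_top :: "nat filter topology" where
  "betaN_top = topology (arbitrary union_of (\<lambda>S. \<exists>A\<subseteq>posN. S = hat A))"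

text \<open>\<open>n\<close> is identified with the principal ultrafilter at \<open>n\<close>.\<close>

definition Nstar :: "nat filter set" where
  "Nstar = betaN - (\<lambda>n. principal {n}) ` posN"

definition Nstar_top :: "nat filter topology" where
  "Nstar_top = subtopology betaN_top Nstar"

text \<open>The continuous extension of \<open>n \<mapsto> n + 1\<close>: \<open>A \<in> tau U\<close> iff \<open>{n. n + 1 \<in> A} \<in> U\<close>.\<close>

definition tau :: "nat filter \<Rightarrow> nat filter" where
  "tau = filtermap (\<lambda>n. n + 1)"

definition tau_pow :: "int \<Rightarrow> nat filter \<Rightarrow> nat filter" where
  "tau_pow k = (if 0 \<le> k then tau ^^ nat k else inv_into Nstar tau ^^ nat (- k))"


section \<open>The quotient space and its flow\<close>

definition cylinder_top :: "(nat filter \<times> real) topology" where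
  "cylinder_top = prod_topology Nstar_top (top_of_set {0..1})"

definition glue :: "nat filter \<times> real \<Rightarrow> nat filter \<times> real \<Rightarrow> bool" where
  "glue p q \<longleftrightarrow> (\<exists>U\<in>Nstar. p = (U, 1) \<and> q = (tau U, 0))"

definition Omega_rel :: "((nat filter \<times> real) \<times> (nat filter \<times> real)) set" where
  "Omega_rel = {(p, q). p \<in> Nstar \<times> {0..1} \<and> q \<in> Nstar \<times> {0..1} \<and> equivclp glue p q}"

definition Omega :: "(nat filter \<times> real) set set" where
  "Omega = (Nstar \<times> {0..1}) // Omega_rel"

definition Omega_class :: "nat filter \<times> real \<Rightarrow> (nat filter \<times> real) set" where
  "Omega_class p = Omega_rel `` {p}"

definition Omega_top :: "(nat filter \<times> real) set topology" where
  "Omega_top = topology (\<lambda>V. V \<subseteq> Omega \<and>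
     openin cylinder_top {p \<in> topspace cylinder_top. Omega_class p \<in> V})"

text \<open>The union is over the representatives of \<open>\<omega>\<close>, all of which give the same class; see
  \<open>flow_Omega_class\<close> below.\<close>

definition flow :: "real \<Rightarrow> (nat filter \<times> real) set \<Rightarrow> (nat filter \<times> real) set" where
  "flow s \<omega> =
     (\<Union>(U, t)\<in>\<omega>. Omega_class (tau_pow \<lfloor>t + s\<rfloor> U, t + s - of_int \<lfloor>t + s\<rfloor>))"

definition R_minus :: "(nat filter \<times> real) set set" where
  "R_minus = {\<omega> \<in> Omega. \<forall>V. openin Omega_top V \<and> \<omega> \<in> V \<longrightarrow>
     (\<forall>R>0. \<exists>s\<ge>R. flow (- s) \<omega> \<in> V)}"


section \<open>The charges\<close>

definition nu_rep :: "nat filter \<times> real \<Rightarrow> nat set \<Rightarrow> real" where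
  "nu_rep = (\<lambda>(U, t) A. let \<theta> = 2 powr t in
     Lim U (\<lambda>n. real (card (A \<inter> {1..nat \<lfloor>\<theta> * 2 ^ n\<rfloor>})) / (\<theta> * 2 ^ n)))"

text \<open>The common value of \<^const>\<open>nu_rep\<close> on the representatives of \<open>\<omega>\<close>; see \<open>nu_Omega_class\<close> below.\<close>

definition nu :: "(nat filter \<times> real) set \<Rightarrow> nat set \<Rightarrow> real" where
  "nu \<omega> A = the_elem ((\<lambda>p. nu_rep p A) ` \<omega>)"


section \<open>Well-definedness\<close>

subsection \<open>Ultrafilters\<close>

lemma ultrafilter_neq_bot: "ultrafilter U \<Longrightarrow> U \<noteq> bot"
  by (simp add: ultrafilter_def)

lemma ultrafilter_cases:
  "ultrafilter U \<Longrightarrow> (\<forall>\<^sub>F x in U. P x) \<or> (\<forall>\<^sub>F x in U. \<not> P x)"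
  unfolding ultrafilter_def by (drule conjunct2, drule spec[of _ "{x. P x}"]) simp

lemma Nstar_iff:
  "U \<in> Nstar \<longleftrightarrow> ultrafilter U \<and> (\<forall>n. \<forall>\<^sub>F m in U. m \<noteq> n)"
proof
  assume U: "U \<in> Nstar"
  then have u: "ultrafilter U" and pos: "\<forall>\<^sub>F n in U. n \<in> posN"
    by (auto simp: Nstar_def betaN_def)
  have "\<forall>\<^sub>F m in U. m \<noteq> n" for n
  proof (rule ccontr)
    assume "\<not> ?thesis"
    then have ev: "\<forall>\<^sub>F m in U. m = n"
      using ultrafilter_cases[OF u, of "\<lambda>m. m = n"] by blast
    have n: "n \<in> posN"
    proof (rule ccontr)
      assume n: "n \<notin> posN"
      have "\<forall>\<^sub>F m in U. False"
        using eventually_conj[OF ev pos] by (rule eventually_mono) (use n in auto)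
      then show False
        using ultrafilter_neq_bot[OF u] by simp
    qed
    have "eventually P U \<longleftrightarrow> P n" for P
    proof
      assume "eventually P U"
      with ev have "\<forall>\<^sub>F m in U. P n" by eventually_elim auto
      then show "P n" using ultrafilter_neq_bot[OF u] by (metis eventually_const)
    next
      assume "P n"
      with ev show "eventually P U" by (auto elim: eventually_mono)
    qed
    then have "U = principal {n}"
      by (simp add: filter_eq_iff eventually_principal)
    with n U show False by (auto simp: Nstar_def)
  qed
  with u show "ultrafilter U \<and> (\<forall>n. \<forall>\<^sub>F m in U. m \<noteq> n)" by blast
next
  assume R: "ultrafilter U \<and> (\<forall>n. \<forall>\<^sub>F m in U. m \<noteq> n)"
  then have "\<forall>\<^sub>F m in U. m \<noteq> 0" by blast
  then have pos: "\<forall>\<^sub>F n in U. n \<in> posN"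
    by (rule eventually_mono) (auto simp: posN_def)
  have "U \<noteq> principal {n}" for n
    using R by (auto simp: eventually_principal)
  with R pos show "U \<in> Nstar" by (auto simp: Nstar_def betaN_def)
qed

lemma ultrafilter_lim_exists:
  fixes f :: "'a \<Rightarrow> real"
  assumes u: "ultrafilter U" and b: "\<And>x. \<bar>f x\<bar> \<le> C"
  shows "(f \<longlongrightarrow> Lim U f) U"
proof -
  have "filtermap f U \<noteq> bot"
    using ultrafilter_neq_bot[OF u] by (simp add: filtermap_bot_iff)
  moreover have "\<forall>\<^sub>F y in filtermap f U. y \<in> {-C..C}"
    using b by (auto simp: eventually_filtermap abs_le_iff minus_le_iff)
  ultimately obtain l where l: "inf (nhds l) (filtermap f U) \<noteq> bot"
    using compact_Icc[of "-C" C] unfolding compact_filter by blast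
  have "(f \<longlongrightarrow> l) U"
  proof (rule topological_tendstoI)
    fix S :: "real set" assume S: "open S" "l \<in> S"
    show "\<forall>\<^sub>F x in U. f x \<in> S"
    proof (rule ccontr)
      assume "\<not> ?thesis"
      then have "\<forall>\<^sub>F x in U. f x \<notin> S"
        using ultrafilter_cases[OF u, of "\<lambda>x. f x \<in> S"] by blast
      then have "\<forall>\<^sub>F y in filtermap f U. y \<notin> S"
        by (simp add: eventually_filtermap)
      moreover have "\<forall>\<^sub>F y in nhds l. y \<in> S"
        using S by (auto simp: eventually_nhds)
      ultimately have "\<forall>\<^sub>F y in inf (nhds l) (filtermap f U). False"
        unfolding eventually_inf by blast
      with l show False by simp
    qed
  qed
  then show ?thesis
    using tendsto_Lim ultrafilter_neq_bot[OF u] by metis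
qed

lemma openin_betaN_top:
  "openin betaN_top = arbitrary union_of (\<lambda>S. \<exists>A\<subseteq>posN. S = hat A)"
proof -
  have "istopology (arbitrary union_of (\<lambda>S. \<exists>A\<subseteq>posN. S = hat A))"
  proof (rule istopology_base)
    fix S T assume "\<exists>A\<subseteq>posN. S = hat A" "\<exists>A\<subseteq>posN. T = hat A"
    then obtain A B where "A \<subseteq> posN" "B \<subseteq> posN" "S = hat A" "T = hat B" by blast
    moreover have "hat A \<inter> hat B = hat (A \<inter> B)"
      by (auto simp: hat_def eventually_conj_iff)
    ultimately show "\<exists>A\<subseteq>posN. S \<inter> T = hat A"
      by (intro exI[of _ "A \<inter> B"]) auto
  qed
  then show ?thesis by (simp add: betaN_top_def)
qed

lemma openin_hat: "A \<subseteq> posN \<Longrightarrow> openin betaN_top (hat A)"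
  unfolding openin_betaN_top by (rule union_of_inc) (auto simp: arbitrary_def)

lemma topspace_betaN_top: "topspace betaN_top = betaN"
proof
  have "hat posN = betaN" by (auto simp: hat_def betaN_def)
  then show "betaN \<subseteq> topspace betaN_top"
    using openin_subset[OF openin_hat[of posN]] by simp
  show "topspace betaN_top \<subseteq> betaN"
    unfolding topspace_def openin_betaN_top union_of_def by (auto simp: hat_def)
qed

lemma topspace_Nstar_top: "topspace Nstar_top = Nstar"
  by (auto simp: Nstar_top_def topspace_betaN_top Nstar_def)

lemma topspace_cylinder_top: "topspace cylinder_top = Nstar \<times> {0..1}"
  by (simp add: cylinder_top_def topspace_Nstar_top)


subsection \<open>The shift\<close>

lemma tau_in_Nstar:
  assumes "U \<in> Nstar"
  shows "tau U \<in> Nstar"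
  unfolding Nstar_iff
proof (intro conjI allI)
  have u: "ultrafilter U" using assms by (simp add: Nstar_iff)
  then show "ultrafilter (tau U)"
    using ultrafilter_cases[OF u]
    by (simp add: ultrafilter_def tau_def filtermap_bot_iff eventually_filtermap)
  show "\<forall>\<^sub>F m in tau U. m \<noteq> n" for n
  proof -
    have "\<forall>\<^sub>F m in U. m \<noteq> n - 1" using assms by (simp add: Nstar_iff)
    then show ?thesis
      by (auto simp: tau_def eventually_filtermap elim: eventually_mono)
  qed
qed

lemma filterlim_tau: "filterlim f F (tau U) \<longleftrightarrow> filterlim (\<lambda>n. f (n + 1)) F U"
  by (simp add: tau_def filterlim_filtermap)

lemma bij_betw_tau: "bij_betw tau Nstar Nstar"
proof -
  have "inj_on tau Nstar"
  proof (rule inj_on_inverseI)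
    show "filtermap (\<lambda>n. n - 1) (tau U) = U" for U
      by (simp add: tau_def filtermap_filtermap filtermap_ident)
  qed
  moreover have "U \<in> tau ` Nstar" if U: "U \<in> Nstar" for U
  proof
    let ?V = "filtermap (\<lambda>n. n - 1) U"
    have u: "ultrafilter U" and ne: "\<And>n. \<forall>\<^sub>F m in U. m \<noteq> n"
      using U by (simp_all add: Nstar_iff)
    show "U = tau ?V"
      unfolding filter_eq_iff
    proof
      fix P :: "nat \<Rightarrow> bool"
      have "\<forall>\<^sub>F n in U. P n = P (n - 1 + 1)"
        using ne[of 0] by eventually_elim simp
      then show "eventually P U = eventually P (tau ?V)"
        unfolding tau_def eventually_filtermap by (rule eventually_subst)
    qed
    have "\<forall>\<^sub>F m in U. m - 1 \<noteq> n" for n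
      using ne[of 0] ne[of "n + 1"] by eventually_elim auto
    then show "?V \<in> Nstar"
      using u ultrafilter_cases[OF u]
      by (simp add: Nstar_iff ultrafilter_def filtermap_bot_iff eventually_filtermap)
  qed
  ultimately show ?thesis
    using tau_in_Nstar by (auto simp: bij_betw_def)
qed

lemma inv_tau_in_Nstar: "U \<in> Nstar \<Longrightarrow> inv_into Nstar tau U \<in> Nstar"
  using bij_betw_tau by (metis bij_betw_def inv_into_into)

lemma tau_pow_in_Nstar:
  assumes "U \<in> Nstar"
  shows "tau_pow k U \<in> Nstar"
proof -
  have "(tau ^^ n) U \<in> Nstar" for n
    by (induction n) (simp_all add: assms tau_in_Nstar)
  moreover have "(inv_into Nstar tau ^^ n) U \<in> Nstar" for n
    by (induction n) (simp_all add: assms inv_tau_in_Nstar)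
  ultimately show ?thesis by (simp add: tau_pow_def)
qed

lemma tau_pow_tau:
  assumes "U \<in> Nstar"
  shows "tau_pow k (tau U) = tau_pow (k + 1) U"
proof (cases "0 \<le> k")
  case True
  then show ?thesis
    by (simp add: tau_pow_def nat_add_distrib funpow_Suc_right del: funpow.simps)
next
  case False
  then obtain n where n: "k = - int (Suc n)"
    by (metis negD not_le)
  have "inv_into Nstar tau (tau U) = U"
    using assms bij_betw_tau by (simp add: bij_betw_def)
  then have "(inv_into Nstar tau ^^ Suc n) (tau U) = (inv_into Nstar tau ^^ n) U"
    by (simp add: funpow_Suc_right del: funpow.simps)
  moreover have "nat (- k) = Suc n" "nat (- (k + 1)) = n"
    using n by auto
  ultimately show ?thesis
    using False by (cases "n = 0") (auto simp: tau_pow_def n simp del: funpow.simps(2))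
qed


subsection \<open>The quotient\<close>

lemma equiv_Omega_rel: "equiv (Nstar \<times> {0..1}) Omega_rel"
proof (rule equivI)
  show "Omega_rel \<subseteq> (Nstar \<times> {0..1}) \<times> (Nstar \<times> {0..1})"
    by (auto simp: Omega_rel_def)
  show "refl_on (Nstar \<times> {0..1}) Omega_rel"
    by (auto simp: refl_on_def Omega_rel_def)
  show "sym Omega_rel"
    by (auto simp: sym_def Omega_rel_def intro: equivclp_sym)
  show "trans Omega_rel"
    by (auto simp: trans_def Omega_rel_def intro: equivclp_trans)
qed

lemma respects_Omega_relI:
  assumes "\<And>U. U \<in> Nstar \<Longrightarrow> f (U, 1) = f (tau U, 0)"
  shows "f respects Omega_rel"
proof (rule congruentI)
  fix p q assume "(p, q) \<in> Omega_rel"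
  then have "equivclp glue p q" by (simp add: Omega_rel_def)
  then show "f p = f q"
    by (induction rule: equivclp_induct) (auto simp: glue_def assms)
qed

lemma Omega_class_in_Omega: "p \<in> Nstar \<times> {0..1} \<Longrightarrow> Omega_class p \<in> Omega"
  unfolding Omega_def Omega_class_def by (rule quotientI)

lemma Omega_cases:
  assumes "\<omega> \<in> Omega"
  obtains U t where "U \<in> Nstar" "t \<in> {0..1}" "\<omega> = Omega_class (U, t)"
  using assms by (auto simp: Omega_def Omega_class_def elim!: quotientE)

lemma openin_Omega_top:
  "openin Omega_top V \<longleftrightarrow>
     V \<subseteq> Omega \<and> openin cylinder_top {p \<in> topspace cylinder_top. Omega_class p \<in> V}"
proof -
  let ?P = "\<lambda>V. {p \<in> topspace cylinder_top. Omega_class p \<in> V}"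
  have "istopology (\<lambda>V. V \<subseteq> Omega \<and> openin cylinder_top (?P V))"
    unfolding istopology_def
  proof (intro conjI allI impI)
    fix S T assume "S \<subseteq> Omega \<and> openin cylinder_top (?P S)"
      and "T \<subseteq> Omega \<and> openin cylinder_top (?P T)"
    moreover have "?P (S \<inter> T) = ?P S \<inter> ?P T" by auto
    ultimately show "openin cylinder_top (?P (S \<inter> T))" by auto
  next
    fix K assume K: "\<forall>V\<in>K. V \<subseteq> Omega \<and> openin cylinder_top (?P V)"
    have "?P (\<Union>K) = (\<Union>V\<in>K. ?P V)" by auto
    with K show "openin cylinder_top (?P (\<Union>K))" by auto
  qed auto
  then show ?thesis by (simp add: Omega_top_def)
qed

lemma topspace_Omega_top: "topspace Omega_top = Omega"
proof
  show "topspace Omega_top \<subseteq> Omega"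
    unfolding topspace_def by (auto simp: openin_Omega_top)
  have "{p \<in> topspace cylinder_top. Omega_class p \<in> Omega} = topspace cylinder_top"
    by (auto simp: topspace_cylinder_top Omega_class_in_Omega)
  then have "openin Omega_top Omega" by (simp add: openin_Omega_top)
  then show "Omega \<subseteq> topspace Omega_top" by (rule openin_subset)
qed

lemma quotient_map_Omega: "quotient_map cylinder_top Omega_top Omega_class"
  unfolding quotient_map_def
proof (intro conjI allI impI)
  show "Omega_class ` topspace cylinder_top = topspace Omega_top"
    unfolding topspace_cylinder_top topspace_Omega_top
    using Omega_class_in_Omega by (auto elim!: Omega_cases)
qed (auto simp: topspace_Omega_top openin_Omega_top)

lemma flow_Omega_class:
  assumes "U \<in> Nstar" "t \<in> {0..1}"
  shows "flow s (Omega_class (U, t)) =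
    Omega_class (tau_pow \<lfloor>t + s\<rfloor> U, t + s - of_int \<lfloor>t + s\<rfloor>)"
proof -
  let ?f = "\<lambda>(U, t). Omega_class (tau_pow \<lfloor>t + s\<rfloor> U, t + s - of_int \<lfloor>t + s\<rfloor>)"
  have "?f respects Omega_rel"
  proof (rule respects_Omega_relI)
    fix U assume "U \<in> Nstar"
    moreover have "\<lfloor>1 + s\<rfloor> = \<lfloor>s\<rfloor> + 1" by linarith
    ultimately show "?f (U, 1) = ?f (tau U, 0)"
      by (simp add: tau_pow_tau add.commute)
  qed
  from UN_equiv_class[OF equiv_Omega_rel this, of "(U, t)"] assms show ?thesis
    by (simp add: flow_def Omega_class_def)
qed

lemma flow_in_Omega:
  assumes "\<omega> \<in> Omega"
  shows "flow s \<omega> \<in> Omega"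
proof -
  obtain U t where "U \<in> Nstar" "t \<in> {0..1}" "\<omega> = Omega_class (U, t)"
    using assms by (rule Omega_cases)
  moreover have "t + s - of_int \<lfloor>t + s\<rfloor> \<in> {0..1}"
    using floor_correct[of "t + s"] unfolding atLeastAtMost_iff by linarith
  ultimately show ?thesis
    by (simp add: flow_Omega_class Omega_class_in_Omega tau_pow_in_Nstar)
qed


subsection \<open>The charges\<close>

lemma nu_quotient_bounds:
  assumes "0 < \<theta>"
  shows "0 \<le> real (card (A \<inter> {1..nat \<lfloor>\<theta> * 2 ^ n\<rfloor>})) / (\<theta> * 2 ^ n)"
    and "real (card (A \<inter> {1..nat \<lfloor>\<theta> * 2 ^ n\<rfloor>})) / (\<theta> * 2 ^ n) \<le> 1"
proof -
  have pos: "0 < \<theta> * 2 ^ n" using assms by simp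
  then show "0 \<le> real (card (A \<inter> {1..nat \<lfloor>\<theta> * 2 ^ n\<rfloor>})) / (\<theta> * 2 ^ n)"
    by simp
  have "card (A \<inter> {1..nat \<lfloor>\<theta> * 2 ^ n\<rfloor>}) \<le> card {1..nat \<lfloor>\<theta> * 2 ^ n\<rfloor>}"
    by (rule card_mono) auto
  then have "card (A \<inter> {1..nat \<lfloor>\<theta> * 2 ^ n\<rfloor>}) \<le> nat \<lfloor>\<theta> * 2 ^ n\<rfloor>" by simp
  moreover have "real (nat \<lfloor>\<theta> * 2 ^ n\<rfloor>) \<le> \<theta> * 2 ^ n"
    using pos by (simp add: of_nat_floor)
  ultimately have "real (card (A \<inter> {1..nat \<lfloor>\<theta> * 2 ^ n\<rfloor>})) \<le> \<theta> * 2 ^ n"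
    by linarith
  with pos show "real (card (A \<inter> {1..nat \<lfloor>\<theta> * 2 ^ n\<rfloor>})) / (\<theta> * 2 ^ n) \<le> 1"
    by simp
qed

lemma tendsto_nu_rep:
  assumes "U \<in> Nstar"
  shows "((\<lambda>n. real (card (A \<inter> {1..nat \<lfloor>2 powr t * 2 ^ n\<rfloor>})) / (2 powr t * 2 ^ n))
    \<longlongrightarrow> nu_rep (U, t) A) U"
  unfolding nu_rep_def Let_def prod.case
proof (rule ultrafilter_lim_exists)
  show "ultrafilter U" using assms by (simp add: Nstar_iff)
  show "\<bar>real (card (A \<inter> {1..nat \<lfloor>2 powr t * 2 ^ n\<rfloor>})) / (2 powr t * 2 ^ n)\<bar> \<le> 1" for n
    using nu_quotient_bounds[of "2 powr t" A n] by simp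
qed

lemma nu_Omega_class:
  assumes "U \<in> Nstar" "t \<in> {0..1}"
  shows "nu (Omega_class (U, t)) A = nu_rep (U, t) A"
proof -
  have resp: "(\<lambda>p. nu_rep p A) respects Omega_rel"
  proof (rule respects_Omega_relI)
    fix U assume U: "U \<in> Nstar"
    let ?q = "\<lambda>x n. real (card (A \<inter> {1..nat \<lfloor>x n\<rfloor>})) / x n"
    have "(?q (\<lambda>n. 2 powr 0 * 2 ^ (n + 1)) \<longlongrightarrow> nu_rep (tau U, 0) A) U"
      using tendsto_nu_rep[OF tau_in_Nstar[OF U], of A 0]
      unfolding filterlim_tau .
    moreover have "(\<lambda>n. (2::real) powr 0 * 2 ^ (n + 1)) = (\<lambda>n. 2 powr 1 * 2 ^ n)"
      by (simp add: fun_eq_iff)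
    then have "?q (\<lambda>n. (2::real) powr 0 * 2 ^ (n + 1)) = ?q (\<lambda>n. 2 powr 1 * 2 ^ n)"
      by (rule arg_cong)
    ultimately have "(?q (\<lambda>n. (2::real) powr 1 * 2 ^ n) \<longlongrightarrow> nu_rep (tau U, 0) A) U"
      by (rule back_subst[of "\<lambda>f. (f \<longlongrightarrow> nu_rep (tau U, 0) A) U"])
    then show "nu_rep (U, 1) A = nu_rep (tau U, 0) A"
      using U by (intro tendsto_unique[OF _ tendsto_nu_rep[OF U, of A 1]])
        (simp_all add: Nstar_iff ultrafilter_neq_bot)
  qed
  have "(U, t) \<in> Nstar \<times> {0..1}" using assms by simp
  then have "(U, t) \<in> Omega_class (U, t)"
    unfolding Omega_class_def by (rule equiv_class_self[OF equiv_Omega_rel])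
  moreover have "nu_rep p A = nu_rep (U, t) A" if "p \<in> Omega_class (U, t)" for p
    using congruentD[OF resp] that by (auto simp: Omega_class_def)
  ultimately have "(\<lambda>p. nu_rep p A) ` Omega_class (U, t) = {nu_rep (U, t) A}"
    by blast
  then show ?thesis by (simp add: nu_def)
qed

lemma charge_nu:
  assumes "\<omega> \<in> Omega"
  shows "charge (nu \<omega>)"
proof -
  obtain U t where U: "U \<in> Nstar" "t \<in> {0..1}" and \<omega>: "\<omega> = Omega_class (U, t)"
    using assms by (rule Omega_cases)
  have nb: "U \<noteq> bot" using U by (simp add: Nstar_iff ultrafilter_neq_bot)
  let ?q = "\<lambda>A n. real (card (A \<inter> {1..nat \<lfloor>2 powr t * 2 ^ n\<rfloor>})) / (2 powr t * 2 ^ n)"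
  have nu: "nu \<omega> A = nu_rep (U, t) A" for A
    by (simp add: \<omega> nu_Omega_class[OF U])
  have lim: "(?q A \<longlongrightarrow> nu \<omega> A) U" for A
    unfolding nu by (rule tendsto_nu_rep[OF U(1)])
  have "0 \<le> nu \<omega> A" for A
    using tendsto_lowerbound[OF lim _ nb] nu_quotient_bounds(1)[of "2 powr t"] by simp
  moreover have "nu \<omega> A \<le> 1" for A
    using tendsto_upperbound[OF lim _ nb] nu_quotient_bounds(2)[of "2 powr t"] by simp
  moreover have "nu \<omega> (A \<union> B) = nu \<omega> A + nu \<omega> B" if "A \<inter> B = {}" for A B
  proof -
    have "card ((A \<union> B) \<inter> {1..m}) = card (A \<inter> {1..m}) + card (B \<inter> {1..m})" for m
      using that by (subst card_Un_disjoint[symmetric]) (auto intro!: arg_cong[where f = card])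
    then have "?q (A \<union> B) = (\<lambda>n. ?q A n + ?q B n)"
      by (simp add: add_divide_distrib)
    then have "(?q (A \<union> B) \<longlongrightarrow> nu \<omega> A + nu \<omega> B) U"
      using tendsto_add[OF lim[of A] lim[of B]] by simp
    then show ?thesis using lim tendsto_unique nb by blast
  qed
  moreover have "nu \<omega> {} = 0"
    using lim[of "{}"] nb tendsto_unique[OF nb _ tendsto_const] by simp
  ultimately show ?thesis unfolding charge_def by blast
qed

end

theory Submission
  imports Defs
begin

text \<open>Write \<open>\<omega> = (U, t)\<close> with \<open>t < 1\<close> and \<open>x n = \<theta> * 2 ^ n\<close>. Recurrence of the negative
  semi-orbit of \<open>\<omega>\<close> amounts to recurrence of \<open>U\<close> under integer shifts: every member of \<open>U\<close>
  belongs to \<open>tau_pow (- k) U\<close> for arbitrarily large \<open>k\<close>.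

  If \<open>U\<close> is not recurrent, it has a member \<open>S\<close> whose gaps below \<open>n \<in> S\<close> tend to infinity along
  \<open>U\<close>. The blocks between consecutive points \<open>x n\<close>, \<open>n \<in> S\<close>, are disjoint, and each fills almost
  all of \<open>{1..x n}\<close>; so \<open>B\<close> may be chosen block by block to agree with \<open>A (i n)\<close>, where \<open>i n\<close>
  grows slowly along \<open>U\<close>.

  If \<open>U\<close> is recurrent, let \<open>A i\<close> be the union of the intervals \<open>{x (j - 1)<..x j}\<close> over those \<open>j\<close>
  that differ modulo \<open>2 ^ i\<close> from the residue selected by \<open>U\<close>. Then \<open>\<nu> (A i) \<le> 1 / 2\<close>, while the
  charge of every negative integer translate of \<open>\<omega>\<close> gives \<open>A i\<close> a value tending to \<open>1\<close>. A set
  \<open>B\<close> that contains all \<open>A i\<close> up to null sets has full charge for these translates, and, by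
  recurrence, \<open>\<nu> B = 1\<close>.\<close>

section \<open>Recurrence of ultrafilters\<close>

lemma ultrafilter_finite_range:
  assumes "ultrafilter U" "finite F" "\<And>x. f x \<in> F"
  obtains r where "\<forall>\<^sub>F x in U. f x = r"
proof (rule ccontr)
  assume "\<not> thesis"
  then have "\<forall>r\<in>F. \<forall>\<^sub>F x in U. f x \<noteq> r"
    using that ultrafilter_cases[OF assms(1)] by blast
  then have "\<forall>\<^sub>F x in U. \<forall>r\<in>F. f x \<noteq> r"
    by (rule eventually_ball_finite[OF assms(2)])
  then have "\<forall>\<^sub>F x in U. False"
    by (rule eventually_mono) (use assms(3) in blast)
  then show False
    using ultrafilter_neq_bot[OF assms(1)] by simp
qed

lemma Nstar_eventually_ge:
  assumes "U \<in> Nstar"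
  shows "\<forall>\<^sub>F n in U. k \<le> n"
proof -
  have "\<forall>\<^sub>F n in U. \<forall>m\<in>{..<k}. n \<noteq> m"
    using assms by (intro eventually_ball_finite) (auto simp: Nstar_iff)
  then show ?thesis
    by (rule eventually_mono) (metis lessThan_iff not_le)
qed

text \<open>The truncated predecessor undoes \<open>n + 1\<close> at every \<open>n\<close>, so
  pushing forward along it undoes \<open>tau\<close> on every filter.\<close>

lemma inv_tau_eq:
  assumes "U \<in> Nstar"
  shows "inv_into Nstar tau U = filtermap (\<lambda>n. n - 1) U"
proof -
  have "tau (inv_into Nstar tau U) = U"
    using assms bij_betw_tau by (metis bij_betw_inv_into_right)
  moreover have "filtermap (\<lambda>n. n - 1) (tau V) = V" for V
    by (simp add: tau_def filtermap_filtermap filtermap_ident)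
  ultimately show ?thesis by metis
qed

lemma tau_pow_minus:
  assumes "U \<in> Nstar"
  shows "tau_pow (- int k) U = filtermap (\<lambda>n. n - k) U"
proof -
  have "(inv_into Nstar tau ^^ k) U \<in> Nstar \<and> (inv_into Nstar tau ^^ k) U = filtermap (\<lambda>n. n - k) U"
  proof (induction k)
    case 0
    then show ?case using assms by (simp add: filtermap_ident)
  next
    case (Suc k)
    define V where "V = (inv_into Nstar tau ^^ k) U"
    have V: "V \<in> Nstar" "V = filtermap (\<lambda>n. n - k) U"
      using Suc unfolding V_def by blast+
    have "inv_into Nstar tau V = filtermap (\<lambda>n. n - Suc k) U"
      unfolding inv_tau_eq[OF V(1)] by (simp add: V(2) filtermap_filtermap)
    then show ?case using inv_tau_in_Nstar[OF V(1)] by (simp add: V_def)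
  qed
  then show ?thesis
    by (cases "k = 0") (auto simp: tau_pow_def)
qed

lemma eventually_tau_pow_minus:
  "U \<in> Nstar \<Longrightarrow> eventually P (tau_pow (- int k) U) \<longleftrightarrow> (\<forall>\<^sub>F n in U. P (n - k))"
  by (simp add: tau_pow_minus eventually_filtermap)

text \<open>By \<open>tau_pow_minus\<close>, the last condition says that \<open>P\<close> holds
  along \<open>tau_pow (- int k) U\<close>. The subtraction truncates only for \<open>n < k\<close>,
  a set outside every free \<open>U\<close>.\<close>

definition shift_recurrent :: "nat filter \<Rightarrow> bool" where
  "shift_recurrent U \<longleftrightarrow>
     (\<forall>P K. eventually P U \<longrightarrow> (\<exists>k\<ge>K. \<forall>\<^sub>F n in U. P (n - k)))"

section \<open>Recurrence in the quotient space versus recurrence of the ultrafilter\<close>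

lemma openin_Nstar_eventually: "openin Nstar_top {U \<in> Nstar. eventually P U}"
proof -
  have "{U \<in> Nstar. eventually P U} = hat {n \<in> posN. P n} \<inter> Nstar"
    by (auto simp: hat_def Nstar_def betaN_def eventually_conj_iff)
  moreover have "openin betaN_top (hat {n \<in> posN. P n})"
    by (rule openin_hat) auto
  ultimately show ?thesis
    by (auto simp: Nstar_top_def openin_subtopology)
qed

text \<open>A return at real time \<open>s\<close> yields an integer return time \<open>k\<close> or
  \<open>k - 1\<close>, according to the side of \<open>c\<close> on which the cylinder coordinate
  lands.\<close>

lemma shift_recurrent_of_R_minus:
  assumes U: "U \<in> Nstar" and t: "0 \<le> t" "t < 1"
    and rec: "Omega_class (U, t) \<in> R_minus"
  shows "shift_recurrent U"
  unfolding shift_recurrent_def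
proof (intro allI impI)
  fix P K assume P: "eventually P U"
  \<comment> \<open>The cut lies strictly between \<open>t\<close> and 1, so that
    \<open>(U, t)\<close> falls into the first summand of \<open>W\<close> and the glued ends avoid
    the cut.\<close>
  define c where "c = (t + 1) / 2"
  have c: "t < c" "0 < c" "c < 1" using t by (auto simp: c_def)
  \<comment> \<open>a saturated neighbourhood: the second summand continues the first one across the glued end
    of the cylinder\<close>
  define W where "W = {U \<in> Nstar. eventually P U} \<times> ({0..1} \<inter> {..<c}) \<union>
      {U \<in> Nstar. \<forall>\<^sub>F n in U. P (n + 1)} \<times> ({0..1} \<inter> {c<..})"
  have W_open: "openin cylinder_top W"
    unfolding W_def cylinder_top_def
    by (intro openin_Un) (auto simp: openin_prod_Times_iff openin_Nstar_eventually openin_open_Int)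
  have resp: "(\<lambda>p. p \<in> W) respects Omega_rel"
  proof (rule respects_Omega_relI)
    show "((V, 1) \<in> W) = ((tau V, 0) \<in> W)" if "V \<in> Nstar" for V
      using that c tau_in_Nstar[OF that]
      by (auto simp: W_def tau_def eventually_filtermap)
  qed
  \<comment> \<open>As \<open>W\<close> is saturated, membership of a class can be tested on any
    representative.\<close>
  have W_iff: "Omega_class p \<in> Omega_class ` W \<longleftrightarrow> p \<in> W" if "p \<in> Nstar \<times> {0..1}" for p
  proof
    assume "Omega_class p \<in> Omega_class ` W"
    then obtain q where "q \<in> W" "Omega_class p = Omega_class q" by blast
    then show "p \<in> W"
      using congruentD[OF resp] eq_equiv_class[OF _ equiv_Omega_rel] that
      by (metis Omega_class_def equiv_Omega_rel equiv_class_self Image_singleton_iff)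
  qed simp
  have W_sub: "W \<subseteq> Nstar \<times> {0..1}" by (auto simp: W_def)
  have "openin Omega_top (Omega_class ` W)"
    unfolding openin_Omega_top
  proof
    show "Omega_class ` W \<subseteq> Omega" using W_sub Omega_class_in_Omega by blast
    have "{p \<in> topspace cylinder_top. Omega_class p \<in> Omega_class ` W} = W"
      using W_iff W_sub by (auto simp: topspace_cylinder_top)
    then show "openin cylinder_top {p \<in> topspace cylinder_top. Omega_class p \<in> Omega_class ` W}"
      using W_open by simp
  qed
  moreover have "(U, t) \<in> W" using U P t c by (auto simp: W_def)
  \<comment> \<open>The margin 2 ensures \<open>K \<le> k - 1\<close> after rounding, for the case
    where the return time is \<open>k - 1\<close>.\<close>
  moreover have "real K + 2 > 0" by simp
  ultimately obtain s where s: "s \<ge> real K + 2" "flow (- s) (Omega_class (U, t)) \<in> Omega_class ` W"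
    using rec unfolding R_minus_def by blast
  define k where "k = nat (- \<lfloor>t - s\<rfloor>)"
  have k: "\<lfloor>t - s\<rfloor> = - int k" "K + 1 \<le> k"
    using s(1) t unfolding k_def by linarith+
  have "Omega_class (tau_pow (- int k) U, t - s + k) \<in> Omega_class ` W"
    using s(2) U t k by (simp add: flow_Omega_class)
  moreover have "t - s + k \<in> {0..1}"
    using floor_correct[of "t - s"] unfolding k(1) atLeastAtMost_iff by simp
  ultimately have "(tau_pow (- int k) U, t - s + k) \<in> W"
    using W_iff tau_pow_in_Nstar[OF U] by (simp del: atLeastAtMost_iff)
  then consider "\<forall>\<^sub>F n in U. P (n - k)" | "\<forall>\<^sub>F n in U. P (n - k + 1)"
    by (auto simp: W_def eventually_tau_pow_minus[OF U])
  then show "\<exists>k\<ge>K. \<forall>\<^sub>F n in U. P (n - k)"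
  proof cases
    case 1
    then show ?thesis using k(2) by (intro exI[of _ k]) simp
  next
    case 2
    with Nstar_eventually_ge[OF U, of k] have "\<forall>\<^sub>F n in U. P (n - (k - 1))"
      by eventually_elim (use k(2) in \<open>simp add: Suc_diff_le\<close>)
    then show ?thesis using k(2) by (intro exI[of _ "k - 1"]) simp
  qed
qed

text \<open>Integer times suffice: the flow at time \<open>- k\<close> keeps \<open>t\<close> and
  shifts only the ultrafilter, so a return to a basic set \<open>hat A\<close> is enough.\<close>

lemma R_minus_of_shift_recurrent:
  assumes U: "U \<in> Nstar" and t: "0 \<le> t" "t < 1" and rec: "shift_recurrent U"
  shows "Omega_class (U, t) \<in> R_minus"
  unfolding R_minus_def
proof (intro CollectI conjI allI impI; (elim conjE)?)
  show "Omega_class (U, t) \<in> Omega" using U t by (simp add: Omega_class_in_Omega)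
next
  fix V and R :: real assume V: "openin Omega_top V" "Omega_class (U, t) \<in> V" and "0 < R"
  have "openin cylinder_top {p \<in> topspace cylinder_top. Omega_class p \<in> V}"
    using V(1) by (simp add: openin_Omega_top)
  moreover have "(U, t) \<in> {p \<in> topspace cylinder_top. Omega_class p \<in> V}"
    using V U t by (simp add: topspace_cylinder_top)
  ultimately obtain G H where G: "openin Nstar_top G" "U \<in> G" "t \<in> H"
    and GH: "G \<times> H \<subseteq> {p \<in> topspace cylinder_top. Omega_class p \<in> V}"
    unfolding cylinder_top_def openin_prod_topology_alt by blast
  from G(1) obtain G' where G': "openin betaN_top G'" "G = G' \<inter> Nstar"
    by (auto simp: Nstar_top_def openin_subtopology)
  then obtain A where A: "U \<in> hat A" "hat A \<subseteq> G'"
    using G(2) unfolding openin_betaN_top union_of_def by blast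
  have "\<forall>\<^sub>F n in U. n \<in> A" using A(1) by (simp add: hat_def)
  then obtain k where k: "k \<ge> nat \<lceil>R\<rceil>" "\<forall>\<^sub>F n in U. n - k \<in> A"
    using rec unfolding shift_recurrent_def by blast
  have "tau_pow (- int k) U \<in> hat A"
    using k(2) tau_pow_in_Nstar[OF U, of "- int k"]
    by (simp add: hat_def eventually_tau_pow_minus[OF U] Nstar_def)
  then have "tau_pow (- int k) U \<in> G"
    using A(2) G'(2) tau_pow_in_Nstar[OF U] by blast
  then have "Omega_class (tau_pow (- int k) U, t) \<in> V" using GH G(3) by blast
  moreover have "\<lfloor>t - real k\<rfloor> = - int k" using t by linarith
  ultimately have "flow (- real k) (Omega_class (U, t)) \<in> V"
    using U t by (simp add: flow_Omega_class)
  moreover have "real k \<ge> R" using k(1) by linarith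
  ultimately show "\<exists>s\<ge>R. flow (- s) (Omega_class (U, t)) \<in> V" by blast
qed

text \<open>Non-recurrence excludes gaps \<open>j \<ge> K\<close> below \<open>n\<close>, each along
  \<open>U\<close>; confining \<open>S\<close> to one residue class modulo \<open>Suc K\<close>
  excludes the gaps \<open>0 < j < K\<close>. For given \<open>k\<close>, finitely many exclusions
  are combined.\<close>

lemma not_shift_recurrent_sparse:
  assumes U: "U \<in> Nstar" and "\<not> shift_recurrent U"
  obtains S where "\<And>k. \<forall>\<^sub>F n in U. n \<in> S \<and> (\<forall>m\<in>S. m < n \<longrightarrow> m + k \<le> n)"
proof -
  have u: "ultrafilter U" using U by (simp add: Nstar_iff)
  from assms(2) obtain P K where P: "eventually P U"
    and K: "\<And>k. k \<ge> K \<Longrightarrow> \<not> (\<forall>\<^sub>F n in U. P (n - k))"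
    unfolding shift_recurrent_def by blast
  obtain r where r: "\<forall>\<^sub>F n in U. n mod Suc K = r"
    using ultrafilter_finite_range[OF u, of "{..K}" "\<lambda>n. n mod Suc K"]
    by (metis atMost_iff finite_atMost less_Suc_eq_le mod_less_divisor zero_less_Suc)
  define S where "S = {n. P n \<and> n mod Suc K = r}"
  have S: "\<forall>\<^sub>F n in U. n \<in> S"
    using P r by eventually_elim (simp add: S_def)
  have step: "\<forall>\<^sub>F n in U. 0 < j \<longrightarrow> j \<le> n \<longrightarrow> n - j \<notin> S" for j
  proof (cases "K \<le> j")
    case True
    then have "\<forall>\<^sub>F n in U. \<not> P (n - j)"
      using K ultrafilter_cases[OF u, of "\<lambda>n. P (n - j)"] by blast
    then show ?thesis by eventually_elim (simp add: S_def)
  next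
    case False
    from S show ?thesis
    proof eventually_elim
      case (elim n)
      show ?case
      proof (intro impI notI)
        assume j: "0 < j" "j \<le> n" "n - j \<in> S"
        then have "n mod Suc K = (n - j) mod Suc K" using elim by (simp add: S_def)
        then have "Suc K dvd n - (n - j)" by (subst (asm) mod_eq_dvd_iff_nat) auto
        then show False using j False by (auto dest: dvd_imp_le)
      qed
    qed
  qed
  have "\<forall>\<^sub>F n in U. n \<in> S \<and> (\<forall>m\<in>S. m < n \<longrightarrow> m + k \<le> n)" for k
  proof -
    have "\<forall>\<^sub>F n in U. \<forall>j\<in>{..<k}. 0 < j \<longrightarrow> j \<le> n \<longrightarrow> n - j \<notin> S"
      using step by (intro eventually_ball_finite) auto
    with S show ?thesis
    proof eventually_elim
      case (elim n)
      have "m + k \<le> n" if "m \<in> S" "m < n" for m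
        using elim(2)[rule_format, of "n - m"] that by fastforce
      with elim(1) show ?case by blast
    qed
  qed
  then show thesis by (rule that)
qed


section \<open>Relative counting\<close>

text \<open>The quotient from \<open>nu_rep\<close> before the limit, so that charges can be
  compared at a single \<open>n\<close>.\<close>

definition dens :: "real \<Rightarrow> nat set \<Rightarrow> nat \<Rightarrow> real" where
  "dens \<theta> A n = real (card (A \<inter> {1..nat \<lfloor>\<theta> * 2 ^ n\<rfloor>})) / (\<theta> * 2 ^ n)"

lemma mem_initial_iff:
  assumes "0 < \<theta>"
  shows "a \<in> {1..nat \<lfloor>\<theta> * 2 ^ n\<rfloor>} \<longleftrightarrow> 1 \<le> a \<and> real a \<le> \<theta> * 2 ^ n"
  using assms by (auto simp: le_nat_iff le_floor_iff)

lemma dens_bounds: "0 < \<theta> \<Longrightarrow> 0 \<le> dens \<theta> A n" "0 < \<theta> \<Longrightarrow> dens \<theta> A n \<le> 1"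
  unfolding dens_def by (fact nu_quotient_bounds)+

lemma dens_le_add:
  assumes "0 < \<theta>"
    and sub: "\<And>a. a \<in> A \<Longrightarrow> 1 \<le> a \<Longrightarrow> real a \<le> \<theta> * 2 ^ n \<Longrightarrow> a \<in> C \<or> a \<in> D"
  shows "dens \<theta> A n \<le> dens \<theta> C n + dens \<theta> D n"
proof -
  let ?I = "{1..nat \<lfloor>\<theta> * 2 ^ n\<rfloor>}"
  have "A \<inter> ?I \<subseteq> (C \<inter> ?I) \<union> (D \<inter> ?I)"
    using sub mem_initial_iff[OF assms(1)] by blast
  then have "card (A \<inter> ?I) \<le> card ((C \<inter> ?I) \<union> (D \<inter> ?I))" by (intro card_mono) auto
  also have "\<dots> \<le> card (C \<inter> ?I) + card (D \<inter> ?I)" by (rule card_Un_le)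
  finally have "real (card (A \<inter> ?I)) \<le> real (card (C \<inter> ?I)) + real (card (D \<inter> ?I))" by linarith
  then show ?thesis
    using assms(1) unfolding dens_def add_divide_distrib[symmetric] by (intro divide_right_mono) auto
qed

text \<open>Each step down in the exponent halves the initial interval.\<close>

lemma dens_initial_le:
  assumes "0 < \<theta>" "k \<le> n"
    and sub: "\<And>a. a \<in> A \<Longrightarrow> 1 \<le> a \<Longrightarrow> real a \<le> \<theta> * 2 ^ n \<Longrightarrow> real a \<le> \<theta> * 2 ^ (n - k)"
  shows "dens \<theta> A n \<le> 1 / 2 ^ k"
proof -
  have "A \<inter> {1..nat \<lfloor>\<theta> * 2 ^ n\<rfloor>} \<subseteq> {1..nat \<lfloor>\<theta> * 2 ^ (n - k)\<rfloor>}"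
    using sub mem_initial_iff[OF assms(1)] by blast
  then have "card (A \<inter> {1..nat \<lfloor>\<theta> * 2 ^ n\<rfloor>}) \<le> card {1..nat \<lfloor>\<theta> * 2 ^ (n - k)\<rfloor>}"
    by (intro card_mono) auto
  then have "card (A \<inter> {1..nat \<lfloor>\<theta> * 2 ^ n\<rfloor>}) \<le> nat \<lfloor>\<theta> * 2 ^ (n - k)\<rfloor>"
    by simp
  then have "real (card (A \<inter> {1..nat \<lfloor>\<theta> * 2 ^ n\<rfloor>})) \<le> real (nat \<lfloor>\<theta> * 2 ^ (n - k)\<rfloor>)"
    by (rule of_nat_mono)
  also have "\<dots> \<le> \<theta> * 2 ^ (n - k)" using assms(1) by (simp add: of_nat_floor)
  finally have "dens \<theta> A n \<le> \<theta> * 2 ^ (n - k) / (\<theta> * 2 ^ n)"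
    using assms(1) unfolding dens_def by (intro divide_right_mono) auto
  also have "\<dots> = 1 / 2 ^ k" using assms(1,2) by (simp add: power_diff)
  finally show ?thesis .
qed

text \<open>The count can only drop while the denominator shrinks by \<open>2 ^ k\<close>; hence
  null sets stay null under negative integer translates.\<close>

lemma dens_shift_le:
  assumes "0 < \<theta>" "k \<le> n"
  shows "dens \<theta> A (n - k) \<le> 2 ^ k * dens \<theta> A n"
proof -
  have "\<theta> * 2 ^ (n - k) \<le> \<theta> * 2 ^ n" using assms(1) by simp
  then have "A \<inter> {1..nat \<lfloor>\<theta> * 2 ^ (n - k)\<rfloor>} \<subseteq> A \<inter> {1..nat \<lfloor>\<theta> * 2 ^ n\<rfloor>}"
    by (intro Int_mono order_refl) (simp add: nat_mono floor_mono)
  then have "card (A \<inter> {1..nat \<lfloor>\<theta> * 2 ^ (n - k)\<rfloor>}) \<le> card (A \<inter> {1..nat \<lfloor>\<theta> * 2 ^ n\<rfloor>})"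
    by (intro card_mono) auto
  then have "dens \<theta> A (n - k) \<le> real (card (A \<inter> {1..nat \<lfloor>\<theta> * 2 ^ n\<rfloor>})) / (\<theta> * 2 ^ (n - k))"
    using assms(1) unfolding dens_def by (intro divide_right_mono) auto
  also have "\<dots> = 2 ^ k * dens \<theta> A n"
    using assms by (simp add: dens_def power_diff)
  finally show ?thesis .
qed

lemma dens_posN_ge:
  assumes "1 \<le> \<theta>"
  shows "1 - 1 / 2 ^ n \<le> dens \<theta> posN n"
proof -
  have "posN \<inter> {1..m} = {1..m}" for m by (auto simp: posN_def)
  moreover have "real (nat \<lfloor>\<theta> * 2 ^ n\<rfloor>) \<ge> \<theta> * 2 ^ n - 1" by linarith
  ultimately have "dens \<theta> posN n \<ge> (\<theta> * 2 ^ n - 1) / (\<theta> * 2 ^ n)"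
    using assms unfolding dens_def by (intro divide_right_mono) auto
  moreover have "(\<theta> * 2 ^ n - 1) / (\<theta> * 2 ^ n) = 1 - 1 / (\<theta> * 2 ^ n)"
    using assms by (simp add: field_simps)
  moreover have "1 / (\<theta> * 2 ^ n) \<le> 1 / 2 ^ n"
    using assms by (intro divide_left_mono) auto
  ultimately show ?thesis by linarith
qed


lemma incseq_dens_limit:
  assumes "U \<noteq> bot" "0 < \<theta>" "\<And>A. (dens \<theta> A \<longlongrightarrow> \<mu> A) U" "incseq A"
  shows "incseq (\<lambda>i. \<mu> (A i))"
proof (rule incseq_SucI)
  show "\<mu> (A i) \<le> \<mu> (A (Suc i))" for i
  proof (rule tendsto_le[OF assms(1) assms(3) assms(3)], rule always_eventually, rule allI)
    have "dens \<theta> {} n = 0" for n by (simp add: dens_def)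
    moreover have "A i \<subseteq> A (Suc i)" using assms(4) by (simp add: incseq_Suc_iff)
    ultimately show "dens \<theta> (A i) n \<le> dens \<theta> (A (Suc i)) n" for n
      using dens_le_add[OF assms(2), of "A i" n "A (Suc i)" "{}"] by auto
  qed
qed


section \<open>The additive property and recurrence\<close>

lemma additive_property_of_not_recurrent:
  assumes U: "U \<in> Nstar" and \<theta>: "0 < \<theta>"
    and lim: "\<And>A. (dens \<theta> A \<longlongrightarrow> \<mu> A) U"
    and nrec: "\<not> shift_recurrent U"
  shows "additive_property \<mu>"
  unfolding additive_property_def
proof (intro allI impI)
  fix \<epsilon> :: real and A :: "nat \<Rightarrow> nat set"
  assume \<epsilon>: "0 < \<epsilon>" and "incseq A \<and> (\<forall>i. A i \<subseteq> posN)"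
  then have inc: "incseq A" and pos: "A i \<subseteq> posN" for i by auto
  have nb: "U \<noteq> bot" using U by (simp add: Nstar_iff ultrafilter_neq_bot)
  have mu0: "0 \<le> \<mu> C" for C
    by (rule tendsto_lowerbound[OF lim _ nb]) (simp add: dens_bounds[OF \<theta>])
  have mu1: "\<mu> C \<le> 1" for C
    by (rule tendsto_upperbound[OF lim _ nb]) (simp add: dens_bounds[OF \<theta>])
  have mono: "incseq (\<lambda>i. \<mu> (A i))"
    using nb \<theta> lim inc by (rule incseq_dens_limit)
  define \<alpha> where "\<alpha> = lim (\<lambda>i. \<mu> (A i))"
  have "convergent (\<lambda>i. \<mu> (A i))"
    using mono mu1 by (meson convergentI incseq_convergent)
  then have "(\<lambda>i. \<mu> (A i)) \<longlonglongrightarrow> \<alpha>" by (simp add: \<alpha>_def convergent_LIMSEQ_iff)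
  then have le_\<alpha>: "\<mu> (A i) \<le> \<alpha>" for i using mono incseq_le by blast
  have \<alpha>0: "0 \<le> \<alpha>" using le_\<alpha>[of 0] mu0[of "A 0"] by linarith
  obtain S where S: "\<And>k. \<forall>\<^sub>F n in U. n \<in> S \<and> (\<forall>m\<in>S. m < n \<longrightarrow> m + k \<le> n)"
    using not_shift_recurrent_sparse[OF U nrec] by blast
  \<comment> \<open>Index \<open>i\<close> is admissible at \<open>n\<close> if the density of
    \<open>A i\<close> at \<open>n\<close> hardly exceeds \<alpha>. Index 0 always is, and
    \<open>i \<le> n\<close> guarantees a greatest one, \<open>h n\<close>.\<close>
  define Q where "Q n i \<longleftrightarrow> i \<le> n \<and> dens \<theta> (A i) n \<le> \<alpha> + 1 / real (Suc i)" for n i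
  define h where "h n = (GREATEST i. Q n i)" for n
  have Q0: "Q n 0" for n
    using dens_bounds(2)[OF \<theta>, of "A 0" n] \<alpha>0 by (simp add: Q_def)
  have Q_bound: "\<And>i. Q n i \<Longrightarrow> i \<le> n" for n by (simp add: Q_def)
  have Q_h: "Q n (h n)" for n
    unfolding h_def using Q0 Q_bound by (rule GreatestI_nat)
  \<comment> \<open>Each fixed \<open>j\<close> is admissible along \<open>U\<close> because
    \<open>\<mu> (A j) \<le> \<alpha>\<close>; so \<open>h\<close> tends to infinity along
    \<open>U\<close>.\<close>
  have h_ge: "\<forall>\<^sub>F n in U. j \<le> h n" for j
  proof -
    have "\<mu> (A j) < \<alpha> + 1 / real (Suc j)"
      using le_\<alpha>[of j] by (smt (verit) of_nat_0_less_iff zero_less_Suc zero_less_divide_1_iff)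
    then have "\<forall>\<^sub>F n in U. dens \<theta> (A j) n < \<alpha> + 1 / real (Suc j)"
      using lim by (rule order_tendstoD(2)[rotated])
    with Nstar_eventually_ge[OF U, of j] show ?thesis
    proof eventually_elim
      case (elim n)
      then have "Q n j" by (simp add: Q_def)
      then show ?case unfolding h_def using Q_bound by (rule Greatest_le_nat)
    qed
  qed
  \<comment> \<open>\<open>block a\<close> is the index in \<open>S\<close> at which the block
    containing \<open>a\<close> ends.\<close>
  define block where "block a = (LEAST n. n \<in> S \<and> real a \<le> \<theta> * 2 ^ n)" for a
  define B where "B = {a \<in> posN. a \<in> A (h (block a))}"
  \<comment> \<open>An earlier block ends at a smaller index in \<open>S\<close>, hence at least
    \<open>k\<close> levels below \<open>n\<close>.\<close>
  have block: "\<forall>\<^sub>F n in U. \<forall>a. real a \<le> \<theta> * 2 ^ n \<longrightarrow> block a = n \<or> real a \<le> \<theta> * 2 ^ (n - k)" for k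
    using S[of k]
  proof eventually_elim
    case (elim n)
    show ?case
    proof (intro allI impI)
      fix a :: nat assume "real a \<le> \<theta> * 2 ^ n"
      then have n: "n \<in> S \<and> real a \<le> \<theta> * 2 ^ n" using elim by simp
      have b: "block a \<in> S" "real a \<le> \<theta> * 2 ^ block a"
        using LeastI[of "\<lambda>n. n \<in> S \<and> real a \<le> \<theta> * 2 ^ n", OF n] by (auto simp: block_def)
      have "block a \<le> n" unfolding block_def using n by (rule Least_le)
      moreover have "real a \<le> \<theta> * 2 ^ (n - k)" if "block a < n"
      proof -
        have "block a \<le> n - k" using elim b(1) that by fastforce
        then have "\<theta> * 2 ^ block a \<le> \<theta> * 2 ^ (n - k)" using \<theta> by simp
        with b(2) show ?thesis by linarith
      qed
      ultimately show "block a = n \<or> real a \<le> \<theta> * 2 ^ (n - k)" by linarith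
    qed
  qed
  have "\<mu> B \<le> \<alpha> + \<epsilon>"
  proof -
    \<comment> \<open>One half of \<epsilon> absorbs the excess of the density of
      \<open>A (h n)\<close> over \<alpha>, the other half the earlier blocks.\<close>
    obtain j where j: "1 / real (Suc j) < \<epsilon> / 2"
      using \<epsilon> nat_approx_posE[of "\<epsilon> / 2"] by auto
    obtain k where k: "(1 / 2) ^ k < \<epsilon> / 2"
      using \<epsilon> real_arch_pow_inv[of "\<epsilon> / 2" "1 / 2"] by auto
    have "\<forall>\<^sub>F n in U. dens \<theta> B n \<le> \<alpha> + \<epsilon>"
      using block[of k] h_ge[of j] Nstar_eventually_ge[OF U, of k]
    proof eventually_elim
      case (elim n)
      let ?D = "{a. real a \<le> \<theta> * 2 ^ (n - k)}"
      have "dens \<theta> B n \<le> dens \<theta> (A (h n)) n + dens \<theta> ?D n"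
        using elim(1) by (intro dens_le_add[OF \<theta>]) (auto simp: B_def)
      moreover have "dens \<theta> ?D n \<le> 1 / 2 ^ k"
        using elim(3) by (intro dens_initial_le[OF \<theta>]) auto
      moreover have "dens \<theta> (A (h n)) n \<le> \<alpha> + 1 / real (Suc (h n))"
        using Q_h[of n] by (simp add: Q_def)
      moreover have "1 / real (Suc (h n)) \<le> 1 / real (Suc j)"
        using elim(2) by (intro divide_left_mono) auto
      ultimately show ?case using j k unfolding power_one_over by linarith
    qed
    then show ?thesis by (rule tendsto_upperbound[OF lim _ nb])
  qed
  moreover have "\<mu> (A i - B) = 0" for i
  proof (rule antisym[OF _ mu0], rule field_le_epsilon)
    fix e :: real assume "0 < e"
    then obtain k where k: "(1 / 2) ^ k < e"
      using real_arch_pow_inv[of e "1 / 2"] by auto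
    have "\<forall>\<^sub>F n in U. dens \<theta> (A i - B) n \<le> e"
      using block[of k] h_ge[of i] Nstar_eventually_ge[OF U, of k]
    proof eventually_elim
      case (elim n)
      \<comment> \<open>Once \<open>i \<le> h n\<close>, the block ending at \<open>n\<close>
        contains no point of \<open>A i - B\<close>.\<close>
      have "dens \<theta> (A i - B) n \<le> 1 / 2 ^ k"
      proof (rule dens_initial_le[OF \<theta> elim(3)])
        fix a assume a: "a \<in> A i - B" "real a \<le> \<theta> * 2 ^ n"
        have "a \<in> A (h n)" using a(1) inc elim(2) by (auto simp: incseq_def)
        then have "block a \<noteq> n" using a(1) pos by (auto simp: B_def)
        then show "real a \<le> \<theta> * 2 ^ (n - k)" using elim(1) a(2) by blast
      qed
      then show ?case using k unfolding power_one_over by linarith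
    qed
    then show "\<mu> (A i - B) \<le> 0 + e" using tendsto_upperbound[OF lim _ nb] by simp
  qed
  moreover have "B \<subseteq> posN" by (auto simp: B_def)
  ultimately show "\<exists>B\<subseteq>posN. \<mu> B \<le> lim (\<lambda>i. \<mu> (A i)) + \<epsilon> \<and> (\<forall>i. \<mu> (A i - B) = 0)"
    unfolding \<alpha>_def by blast
qed

section \<open>Recurrent case: a sequence built from residue classes modulo powers of two\<close>

lemma not_additive_property_of_recurrent:
  assumes U: "U \<in> Nstar" and \<theta>: "1 \<le> \<theta>"
    and lim: "\<And>A. (dens \<theta> A \<longlongrightarrow> \<mu> A) U"
    and rec: "shift_recurrent U"
  shows "\<not> additive_property \<mu>"
proof
  assume add: "additive_property \<mu>"
  have u: "ultrafilter U" using U by (simp add: Nstar_iff)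
  have nb: "U \<noteq> bot" using u by (rule ultrafilter_neq_bot)
  have \<theta>0: "0 < \<theta>" using \<theta> by simp
  \<comment> \<open>The residue class modulo \<open>2 ^ i\<close> that belongs to \<open>U\<close>.
    Powers of two make these classes nested, so that the sets \<open>A i\<close> below
    increase.\<close>
  define T where "T i = {j :: nat. \<forall>\<^sub>F n in U. n mod 2 ^ i = j mod 2 ^ i}" for i :: nat
  have T_U: "\<forall>\<^sub>F n in U. n \<in> T i" for i
  proof -
    obtain r where r: "\<forall>\<^sub>F n in U. n mod 2 ^ i = r"
      using ultrafilter_finite_range[OF u, of "{..<2 ^ i}" "\<lambda>n. n mod 2 ^ i"] by auto
    from r show ?thesis
    proof eventually_elim
      case (elim n)
      with r show ?case by (simp add: T_def)
    qed
  qed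
  have T_cong: "j mod 2 ^ i = n mod 2 ^ i" if "j \<in> T i" "n \<in> T i" for i j n
  proof -
    have "\<forall>\<^sub>F m in U. j mod 2 ^ i = n mod 2 ^ i"
      using that unfolding T_def mem_Collect_eq by eventually_elim simp
    then show ?thesis using nb by (simp add: eventually_const)
  qed
  have T_anti: "T (Suc i) \<subseteq> T i" for i
  proof -
    have "a mod 2 ^ i = b mod 2 ^ i" if "a mod 2 ^ Suc i = b mod 2 ^ Suc i" for a b :: nat
      using arg_cong[OF that, of "\<lambda>x. x mod 2 ^ i"] by (simp add: mod_mod_cancel)
    then have "\<forall>\<^sub>F n in U. n mod 2 ^ i = j mod 2 ^ i"
      if "\<forall>\<^sub>F n in U. n mod 2 ^ Suc i = j mod 2 ^ Suc i" for j
      using that by (rule eventually_mono[rotated])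
    then show ?thesis unfolding T_def by blast
  qed
  \<comment> \<open>For \<open>j > 0\<close>, level \<open>j\<close> is the interval
    \<open>{x (j - 1)<..x j}\<close>; level 0 holds everything up to \<theta>.\<close>
  define level where "level a = (LEAST j. real a \<le> \<theta> * 2 ^ j)" for a :: nat
  have level_ex: "\<exists>j. real a \<le> \<theta> * 2 ^ j" for a :: nat
  proof
    have "real a \<le> 2 ^ a" using less_exp[of a] by (metis less_imp_le of_nat_le_numeral_power_cancel_iff)
    also have "\<dots> \<le> \<theta> * 2 ^ a" using \<theta> by simp
    finally show "real a \<le> \<theta> * 2 ^ a" .
  qed
  have level: "level a \<le> j \<longleftrightarrow> real a \<le> \<theta> * 2 ^ j" for a j
  proof
    assume "level a \<le> j"
    then have "\<theta> * 2 ^ level a \<le> \<theta> * 2 ^ j" using \<theta>0 by simp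
    moreover have "real a \<le> \<theta> * 2 ^ level a" unfolding level_def using level_ex by (rule LeastI_ex)
    ultimately show "real a \<le> \<theta> * 2 ^ j" by linarith
  qed (simp add: level_def Least_le)
  define A where "A i = {a \<in> posN. level a \<notin> T i}" for i
  have inc: "incseq A" using T_anti by (auto simp: incseq_Suc_iff A_def)
  have mu_A: "\<mu> (A i) \<le> 1 / 2" for i
  proof (rule tendsto_upperbound[OF lim _ nb])
    show "\<forall>\<^sub>F n in U. dens \<theta> (A i) n \<le> 1 / 2"
      using T_U[of i] Nstar_eventually_ge[OF U, of 1]
    proof eventually_elim
      case (elim n)
      \<comment> \<open>The top level \<open>n\<close> is in \<open>T i\<close>, hence absent from
        \<open>A i\<close>; what remains lies in the lower half.\<close>
      have "real a \<le> \<theta> * 2 ^ (n - 1)" if "a \<in> A i" "real a \<le> \<theta> * 2 ^ n" for a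
      proof -
        have "level a \<noteq> n" "level a \<le> n" using that elim by (auto simp: A_def level)
        then have "level a \<le> n - 1" by linarith
        then show ?thesis by (simp add: level)
      qed
      then show ?case using dens_initial_le[OF \<theta>0 elim(2), of "A i"] by simp
    qed
  qed
  obtain B where B: "\<mu> B \<le> lim (\<lambda>i. \<mu> (A i)) + 1 / 4" "\<And>i. \<mu> (A i - B) = 0"
  proof -
    have "incseq A \<and> (\<forall>i. A i \<subseteq> posN)" using inc by (auto simp: A_def)
    moreover have "(0 :: real) < 1 / 4" by simp
    ultimately show thesis
      using add that unfolding additive_property_def by blast
  qed
  have "incseq (\<lambda>i. \<mu> (A i))"
    using nb \<theta>0 lim inc by (rule incseq_dens_limit)
  then have "convergent (\<lambda>i. \<mu> (A i))"
    using mu_A by (meson convergentI incseq_convergent)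
  then have "lim (\<lambda>i. \<mu> (A i)) \<le> 1 / 2"
    using mu_A by (intro LIMSEQ_le_const2[of "\<lambda>i. \<mu> (A i)"]) (auto simp: convergent_LIMSEQ_iff)
  \<comment> \<open>Since 7/8 lies strictly above 1/2 + 1/4, the bound passes to the quotients along
    \<open>U\<close>, and recurrence carries it to some \<open>n - k\<close>.\<close>
  with B(1) have "\<mu> B < 7 / 8" by simp
  then have "\<forall>\<^sub>F n in U. dens \<theta> B n < 7 / 8" by (rule order_tendstoD(2)[OF lim])
  then obtain k where k: "\<forall>\<^sub>F n in U. dens \<theta> B (n - k) < 7 / 8" and k1: "1 \<le> k"
    using rec unfolding shift_recurrent_def by blast
  \<comment> \<open>Indices in \<open>T i\<close> below \<open>n\<close> are at most
    \<open>n - 2 ^ i\<close>; \<open>k + 5 \<le> 2 ^ i\<close> puts them at least 5 levels below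
    \<open>n - k\<close>.\<close>
  define i where "i = k + 5"
  have "i < 2 ^ i" by (rule less_exp)
  then have M: "k + 5 \<le> 2 ^ i" by (simp add: i_def)
  \<comment> \<open>The factor \<open>2 ^ k\<close> cancels the one in
    \<open>dens_shift_le\<close>.\<close>
  have "\<forall>\<^sub>F n in U. dens \<theta> (A i - B) n < 1 / (32 * 2 ^ k)"
    using B(2)[of i] by (intro order_tendstoD(2)[OF lim]) simp
  with k T_U[of i] Nstar_eventually_ge[OF U, of "2 ^ i"]
  have "\<forall>\<^sub>F n in U. False"
  proof eventually_elim
    case (elim n)
    have kn: "k \<le> n" "k + 5 \<le> n" using M elim(3) by auto
    have small: "1 / 2 ^ m \<le> (1 / 32 :: real)" if "5 \<le> m" for m
    proof -
      have "(2 :: real) ^ 5 \<le> 2 ^ m" using that by (intro power_increasing) auto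
      then show ?thesis by (intro divide_left_mono) auto
    qed
    have "dens \<theta> posN (n - k) \<le> dens \<theta> B (n - k) + dens \<theta> (posN - B) (n - k)"
      by (rule dens_le_add[OF \<theta>0]) auto
    moreover have "dens \<theta> (posN - B) (n - k) \<le> dens \<theta> (A i - B) (n - k) + dens \<theta> (posN - A i) (n - k)"
      by (rule dens_le_add[OF \<theta>0]) auto
    moreover have "dens \<theta> (A i - B) (n - k) \<le> 1 / 32"
    proof -
      have "2 ^ k * dens \<theta> (A i - B) n \<le> 2 ^ k * (1 / (32 * 2 ^ k))"
        using elim(4) by (intro mult_left_mono) auto
      then show ?thesis using dens_shift_le[OF \<theta>0 kn(1), of "A i - B"] by simp
    qed
    moreover have "dens \<theta> (posN - A i) (n - k) \<le> 1 / 32"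
    proof -
      have "dens \<theta> (posN - A i) (n - k) \<le> 1 / 2 ^ (2 ^ i - k)"
      proof (rule dens_initial_le[OF \<theta>0])
        show "2 ^ i - k \<le> n - k" using elim(3) by simp
        fix a assume "a \<in> posN - A i" "real a \<le> \<theta> * 2 ^ (n - k)"
        then have l: "level a \<in> T i" "level a \<le> n - k" by (auto simp: A_def level)
        then have "n mod 2 ^ i = level a mod 2 ^ i" using T_cong elim(2) by blast
        then have "2 ^ i dvd n - level a" using l(2) by (subst (asm) mod_eq_dvd_iff_nat) auto
        \<comment> \<open>\<open>1 \<le> k\<close> rules out \<open>level a = n\<close>, so the
          multiple of \<open>2 ^ i\<close> is positive.\<close>
        moreover have "0 < n - level a" using l(2) k1 kn(1) by linarith
        ultimately have "2 ^ i \<le> n - level a" by (rule dvd_imp_le)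
        then have "level a \<le> n - k - (2 ^ i - k)" using M elim(3) by linarith
        then show "real a \<le> \<theta> * 2 ^ (n - k - (2 ^ i - k))" by (simp only: level)
      qed
      also have "\<dots> \<le> 1 / 32" using M by (intro small) linarith
      finally show ?thesis .
    qed
    moreover have "1 - 1 / 32 \<le> dens \<theta> posN (n - k)"
      using dens_posN_ge[OF \<theta>, of "n - k"] small[of "n - k"] kn by linarith
    \<comment> \<open>The density of \<open>posN\<close> at \<open>n - k\<close> would be at least
      31/32 and below 7/8 + 1/32 + 1/32 = 30/32.\<close>
    ultimately show ?case using elim(1) by linarith
  qed
  then show False using nb by simp
qed

theorem theorem5p2:
  fixes \<omega> :: "(nat filter \<times> real) set"
  assumes "\<omega> \<in> Omega"
  shows "additive_property (nu \<omega>) \<longleftrightarrow> \<omega> \<notin> R_minus"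
proof -
  \<comment> \<open>A representative with \<open>t < 1\<close> exists because \<open>(V, 1)\<close>
    is glued to \<open>(tau V, 0)\<close>.\<close>
  obtain U t where U: "U \<in> Nstar" and t: "0 \<le> t" "t < 1" and \<omega>: "\<omega> = Omega_class (U, t)"
  proof -
    obtain V s where V: "V \<in> Nstar" "s \<in> {0..1}" "\<omega> = Omega_class (V, s)"
      using assms by (rule Omega_cases)
    show thesis
    proof (cases "s = 1")
      case False
      then show thesis using V that by auto
    next
      case True
      have "glue (V, 1) (tau V, 0)" using V(1) by (auto simp: glue_def)
      then have "((V, 1), (tau V, 0)) \<in> Omega_rel"
        using V(1) tau_in_Nstar by (auto simp: Omega_rel_def)
      then have "Omega_class (V, 1) = Omega_class (tau V, 0)"
        unfolding Omega_class_def by (rule equiv_class_eq[OF equiv_Omega_rel])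
      then show thesis using V True tau_in_Nstar by (intro that[of "tau V" 0]) auto
    qed
  qed
  have lim: "(dens (2 powr t) A \<longlongrightarrow> nu \<omega> A) U" for A
    using tendsto_nu_rep[OF U, of A t] U t unfolding dens_def by (simp add: \<omega> nu_Omega_class)
  have \<theta>: "1 \<le> 2 powr t" using t by (simp add: ge_one_powr_ge_zero)
  have "\<omega> \<in> R_minus \<longleftrightarrow> shift_recurrent U"
    using shift_recurrent_of_R_minus[OF U t] R_minus_of_shift_recurrent[OF U t] \<omega> by blast
  moreover have "additive_property (nu \<omega>) \<longleftrightarrow> \<not> shift_recurrent U"
    using additive_property_of_not_recurrent[OF U _ lim]
      not_additive_property_of_recurrent[OF U \<theta> lim] by auto
  ultimately show ?thesis by blast
qed

end
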